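(* Let $C\in\mathbb{C}^{n\times n}$. Then $$r^\vee(C)=\min\left\{\operatorname{Tr} X:\ X\in\mathrm{H}_n,\ \begin{bmatrix} X& C\\ C^*& X\end{bmatrix}\in \mathrm{H}_{2n,+}\right\}.$$
   Context: $\mathrm{H}_n$ denotes the real space of $n\times n$ complex Hermitian matrices and $\mathrm{H}_{k,+}$ the closed cone of $k\times k$ complex Hermitian positive semidefinite matrices. For $C\in\mathbb{C}^{n\times n}$ the numerical radius is $r(C)=\max\{|\mathbf{x}^*C\mathbf{x}|:\ \mathbf{x}\in\mathbb{C}^n,\ \|\mathbf{x}\|=1\}$, where $\|\mathbf{x}\|=\sqrt{\mathbf{x}^*\mathbf{x}}$, and its dual norm is $r^\vee(C)=\max\{\operatorname{Re}\operatorname{Tr}(F^*C):\ F\in\mathbb{C}^{n\times n},\ r(F)\le 1\}$. *)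

theory Defs
  imports "HOL-Analysis.Analysis"
begin

text \<open>Matrices in \<open>\<complex>\<^sup>n\<^sup>\<times>\<^sup>n\<close> are terms of type \<open>complex^'n^'n\<close> with \<open>'n\<close> an
  arbitrary finite index type; the library norm on \<open>complex^'n\<close> is \<open>sqrt (x\<^sup>* x)\<close>.\<close>

definition ctranspose :: "complex^'n^'m \<Rightarrow> complex^'m^'n" where
  "ctranspose A = (\<chi> i j. cnj (A $ j $ i))"

definition hermitian :: "complex^'n^'n \<Rightarrow> bool" where
  "hermitian A \<longleftrightarrow> ctranspose A = A"

text \<open>The value \<open>x\<^sup>* A x\<close>.\<close>
definition quad_form :: "complex^'n^'n \<Rightarrow> complex^'n \<Rightarrow> complex" where
  "quad_form A x = (\<Sum>i\<in>UNIV. cnj (x $ i) * (A *v x) $ i)"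

text \<open>\<open>Re\<close> only changes the type here: \<open>x\<^sup>* A x\<close> is real for Hermitian \<open>A\<close>.\<close>
definition psd :: "complex^'n^'n \<Rightarrow> bool" where
  "psd A \<longleftrightarrow> hermitian A \<and> (\<forall>x. 0 \<le> Re (quad_form A x))"

text \<open>The \<open>2 \<times> 2\<close> block matrix with rows \<open>(A, B)\<close> and \<open>(C, D)\<close>. The index type
  \<open>'n + 'n\<close> has \<open>2n\<close> elements; \<open>Inl\<close> indexes the first block and \<open>Inr\<close> the second.\<close>
definition block2 ::
  "complex^'n^'n \<Rightarrow> complex^'n^'n \<Rightarrow> complex^'n^'n \<Rightarrow> complex^'n^'n \<Rightarrow> complex^('n + 'n)^('n + 'n)" where
  "block2 A B C D = (\<chi> p q. case p of
       Inl i \<Rightarrow> (case q of Inl j \<Rightarrow> A $ i $ j | Inr j \<Rightarrow> B $ i $ j)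
     | Inr i \<Rightarrow> (case q of Inl j \<Rightarrow> C $ i $ j | Inr j \<Rightarrow> D $ i $ j))"

text \<open>Both maxima below are genuine maxima, not just suprema: see
  \<open>numerical_radius_attained\<close> and \<open>dual_numerical_radius_attained\<close>.\<close>
definition numerical_radius :: "complex^'n^'n \<Rightarrow> real" where
  "numerical_radius C = (GREATEST v. v \<in> {cmod (quad_form C x) | x. norm x = 1})"

definition dual_numerical_radius :: "complex^'n^'n \<Rightarrow> real" where
  "dual_numerical_radius C =
     (GREATEST v. v \<in> {Re (trace (ctranspose F ** C)) | F. numerical_radius F \<le> 1})"

lemma quad_form_expand:
  "quad_form A x = (\<Sum>i\<in>UNIV. \<Sum>j\<in>UNIV. cnj (x $ i) * (A $ i $ j * x $ j))"
  by (simp add: quad_form_def matrix_vector_mult_def sum_distrib_left)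

lemma greatest_on_compact:
  fixes g :: "'a::topological_space \<Rightarrow> real"
  assumes "compact S" "S \<noteq> {}" "continuous_on S g"
  defines "m \<equiv> (GREATEST v. v \<in> {g x | x. x \<in> S})"
  shows "m \<in> {g x | x. x \<in> S}" and "\<And>x. x \<in> S \<Longrightarrow> g x \<le> m"
proof -
  obtain x0 where x0: "x0 \<in> S" "\<forall>y\<in>S. g y \<le> g x0"
    using continuous_attains_sup[OF assms(1-3)] by blast
  have "m = g x0"
    unfolding m_def by (rule Greatest_equality) (use x0 in auto)
  with x0 show "m \<in> {g x | x. x \<in> S}" and "\<And>x. x \<in> S \<Longrightarrow> g x \<le> m" by auto
qed

lemma numerical_radius_attained:
  fixes C :: "complex^'n^'n"
  shows "numerical_radius C \<in> {cmod (quad_form C x) | x. norm x = 1}"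
    and "\<And>x. norm x = 1 \<Longrightarrow> cmod (quad_form C x) \<le> numerical_radius C"
proof -
  have ne: "sphere (0 :: complex^'n) 1 \<noteq> {}"
    by simp
  have cont: "continuous_on (sphere 0 1) (\<lambda>x. cmod (quad_form C x))"
    unfolding quad_form_expand by (intro continuous_intros)
  note * = greatest_on_compact[OF compact_sphere ne cont]
  show "numerical_radius C \<in> {cmod (quad_form C x) | x. norm x = 1}"
    and "\<And>x. norm x = 1 \<Longrightarrow> cmod (quad_form C x) \<le> numerical_radius C"
    using * by (simp_all add: numerical_radius_def)
qed

lemma numerical_radius_le_iff:
  "numerical_radius F \<le> b \<longleftrightarrow> (\<forall>x. norm x = 1 \<longrightarrow> cmod (quad_form F x) \<le> b)"
  using numerical_radius_attained[where C = F] by fastforce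

lemma cmod_quad_form_le:
  "cmod (quad_form F x) \<le> numerical_radius F * (norm x)\<^sup>2"
proof (cases "x = 0")
  case True
  then show ?thesis by (simp add: quad_form_def)
next
  case False
  define y where "y = inverse (norm x) *\<^sub>R x"
  have y: "norm y = 1" using False by (simp add: y_def)
  have x: "x = norm x *\<^sub>R y" using False by (simp add: y_def)
  have "quad_form F (norm x *\<^sub>R y) = (norm x)\<^sup>2 *\<^sub>R quad_form F y"
    by (simp add: quad_form_expand scaleR_sum_right power2_eq_square algebra_simps)
  then have "quad_form F x = (norm x)\<^sup>2 *\<^sub>R quad_form F y"
    using x by metis
  then have "cmod (quad_form F x) = (norm x)\<^sup>2 * cmod (quad_form F y)"
    by simp
  also have "\<dots> \<le> (norm x)\<^sup>2 * numerical_radius F"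
    by (intro mult_left_mono numerical_radius_attained(2) y) simp
  finally show ?thesis by (simp add: mult.commute)
qed

lemma quad_form_axis_sum:
  fixes F :: "complex^'n^'n"
  shows "quad_form F (axis i a + axis j b) =
    cnj a * F $ i $ i * a + cnj a * F $ i $ j * b + cnj b * F $ j $ i * a + cnj b * F $ j $ j * b"
proof -
  have s: "(\<Sum>k\<in>UNIV. cnj ((axis l c :: complex^'n) $ k) * h k) = cnj c * h l"
    for l c and h :: "'n \<Rightarrow> complex"
  proof -
    have "(\<Sum>k\<in>UNIV. cnj ((axis l c :: complex^'n) $ k) * h k) = (\<Sum>k\<in>UNIV. if k = l then cnj c * h k else 0)"
      by (rule sum.cong) (auto simp: axis_def)
    then show ?thesis by simp
  qed
  have u: "(F *v axis l c) $ k = F $ k $ l * c" for l c k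
  proof -
    have "(F *v axis l c) $ k = (\<Sum>m\<in>UNIV. if m = l then F $ k $ m * c else 0)"
      unfolding matrix_vector_mult_def vec_lambda_beta by (rule sum.cong) (auto simp: axis_def)
    then show ?thesis by simp
  qed
  have "quad_form F (axis i a + axis j b) =
    (\<Sum>k\<in>UNIV. cnj ((axis i a :: complex^'n) $ k) * (F $ k $ i * a + F $ k $ j * b)) +
    (\<Sum>k\<in>UNIV. cnj ((axis j b :: complex^'n) $ k) * (F $ k $ i * a + F $ k $ j * b))"
    by (simp add: quad_form_def matrix_vector_right_distrib u distrib_right sum.distrib)
  also have "\<dots> = cnj a * (F $ i $ i * a + F $ i $ j * b) + cnj b * (F $ j $ i * a + F $ j $ j * b)"
    by (simp only: s)
  finally show ?thesis by (simp add: algebra_simps)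
qed

lemma norm_entry_le:
  fixes F :: "complex^'n^'n"
  shows "cmod (F $ i $ j) \<le> 8 * numerical_radius F"
proof -
  have nr0: "0 \<le> numerical_radius F"
    using numerical_radius_attained(1)[where C = F] by auto
  have na: "norm (axis k c :: complex^'n) = cmod c" for k c
  proof -
    have "(\<Sum>m\<in>UNIV. (norm ((axis k c :: complex^'n) $ m))\<^sup>2) = (\<Sum>m\<in>UNIV. if m = k then (cmod c)\<^sup>2 else 0)"
      by (rule sum.cong) (auto simp: axis_def)
    then show ?thesis by (simp add: norm_vec_def L2_set_def)
  qed
  have b: "cmod (quad_form F (axis i 1 + axis j c)) \<le> numerical_radius F * 4" if "cmod c = 1" for c
  proof -
    have "norm (axis i 1 + axis j c :: complex^'n) \<le> 2"
      using norm_triangle_ineq[of "axis i 1 :: complex^'n" "axis j c"] that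
      by (simp add: na)
    then have "(norm (axis i 1 + axis j c :: complex^'n))\<^sup>2 \<le> 2\<^sup>2"
      by (intro power_mono) auto
    then show ?thesis
      using order_trans[OF cmod_quad_form_le mult_left_mono[OF _ nr0]] by fastforce
  qed
  let ?q = "\<lambda>c. quad_form F (axis i 1 + axis j c)"
  have "4 * F $ i $ j = ?q 1 - ?q (-1) - \<i> * ?q \<i> + \<i> * ?q (-\<i>)"
    by (simp add: quad_form_axis_sum algebra_simps)
  then have "4 * cmod (F $ i $ j) = cmod (?q 1 - ?q (-1) - \<i> * ?q \<i> + \<i> * ?q (-\<i>))"
    by (metis norm_mult norm_numeral)
  also have "\<dots> \<le> cmod (?q 1) + cmod (?q (-1)) + cmod (\<i> * ?q \<i>) + cmod (\<i> * ?q (-\<i>))"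
    by (intro norm_triangle_le norm_triangle_le_diff add_right_mono order_refl)
  also have "\<dots> \<le> 16 * numerical_radius F"
    using b[of 1] b[of "-1"] b[of "\<i>"] b[of "-\<i>"] by (simp add: norm_mult)
  finally show ?thesis using nr0 by simp
qed

lemma dual_numerical_radius_attained:
  fixes C :: "complex^'n^'n"
  shows "dual_numerical_radius C \<in> {Re (trace (ctranspose F ** C)) | F. numerical_radius F \<le> 1}"
    and "\<And>F. numerical_radius F \<le> 1 \<Longrightarrow> Re (trace (ctranspose F ** C)) \<le> dual_numerical_radius C"
proof -
  define S where "S = {F :: complex^'n^'n. numerical_radius F \<le> 1}"
  have "0 \<in> S" by (simp add: S_def numerical_radius_le_iff quad_form_expand)
  then have ne: "S \<noteq> {}" by blast
  have "closed S"
    unfolding S_def numerical_radius_le_iff quad_form_expand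
    by (intro closed_Collect_all closed_Collect_imp closed_Collect_le open_Collect_const
        continuous_intros)
  moreover have "bounded S"
  proof (rule boundedI)
    fix F assume "F \<in> S"
    then have e: "cmod (F $ i $ j) \<le> 8" for i j
      using norm_entry_le[of F i j] by (simp add: S_def)
    have r: "norm (F $ i) \<le> (\<Sum>j\<in>(UNIV::'n set). 8)" for i
      unfolding norm_vec_def[of "F $ i"]
      by (rule order_trans[OF L2_set_le_sum], simp only: norm_ge_zero, intro sum_mono e)
    show "norm F \<le> (\<Sum>i\<in>(UNIV::'n set). \<Sum>j\<in>(UNIV::'n set). 8)"
      unfolding norm_vec_def[of F]
      by (rule order_trans[OF L2_set_le_sum], simp only: norm_ge_zero, intro sum_mono r)
  qed
  ultimately have comp: "compact S" by (simp add: compact_eq_bounded_closed)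
  have cont: "continuous_on S (\<lambda>F. Re (trace (ctranspose F ** C)))"
    unfolding trace_def ctranspose_def matrix_matrix_mult_def
    by (simp) (intro continuous_intros)
  note * = greatest_on_compact[OF comp ne cont]
  show "dual_numerical_radius C \<in> {Re (trace (ctranspose F ** C)) | F. numerical_radius F \<le> 1}"
    and "\<And>F. numerical_radius F \<le> 1 \<Longrightarrow> Re (trace (ctranspose F ** C)) \<le> dual_numerical_radius C"
    using * by (simp_all add: dual_numerical_radius_def S_def)
qed

end

theory Submission
  imports Defs
begin

text \<open>
  Write \<open>\<langle>F, C\<rangle>\<close> for \<open>Re (trace (F\<^sup>* C))\<close> and call \<open>X\<close> feasible for \<open>C\<close> if the block matrix with
  diagonal blocks \<open>X, X\<close> and off-diagonal blocks \<open>C, C\<^sup>*\<close> is positive semidefinite. The numerical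
  radius is the support function of the compact set of all \<open>c x x\<^sup>*\<close> with \<open>cmod c = 1\<close> and
  \<open>norm x = 1\<close>.

  The minimum is attained because of a separation argument: the convex hull of these matrices is the
  unit ball of the dual norm (\<open>mem_scaled_hull\<close>), so \<open>C\<close> is the dual norm times a convex combination
  of matrices \<open>c x x\<^sup>*\<close>. The same combination of the matrices \<open>x x\<^sup>*\<close>, scaled by the dual norm, is
  feasible for \<open>C\<close> and has the right trace (\<open>hull_feasible\<close>).

  Conversely, every feasible \<open>X\<close> satisfies \<open>\<langle>F, C\<rangle> \<le> trace X\<close> whenever the numerical radius of \<open>F\<close> is
  at most one (\<open>weak_duality\<close>). One way to see this would be to factor the block matrix through a
  unitary matrix and to diagonalise it; the proof below replaces the spectral theorem by a stationary
  chain. Averaging over roots of unity, the bound on \<open>F\<close> gives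
  \<open>Re (\<Sum>k<m. a\<^sub>k\<^sup>* F a\<^sub>k\<^sub>+\<^sub>1) \<le> (\<Sum>k\<le>m. (norm a\<^sub>k)\<^sup>2)\<close> for arbitrary vectors
  (\<open>chain_inequality\<close>). For invertible \<open>X\<close> put \<open>N = C\<^sup>* X\<^sup>-\<^sup>1\<close>. The recursion
  \<open>a\<^sub>k\<^sub>+\<^sub>1 = N a\<^sub>k\<close>, with fresh independent vectors of covariance \<open>X - N X N\<^sup>*\<close> added at each step,
  preserves the covariance \<open>X\<close> and has \<open>C\<close> as covariance of consecutive vectors; positivity of the Schur
  complement \<open>X - C\<^sup>* X\<^sup>-\<^sup>1 C\<close> is what makes this possible. The chain inequality for such a chain
  says \<open>m \<langle>F, C\<rangle> \<le> (m + 1) trace X\<close>, and \<open>m \<rightarrow> \<infinity>\<close> gives the claim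
  (\<open>trace_bound_of_stationary\<close>).
\<close>

section \<open>The Hermitian inner product and rank-one matrices\<close>

definition cdot :: "complex^'n \<Rightarrow> complex^'n \<Rightarrow> complex" where
  "cdot u v = (\<Sum>i\<in>UNIV. cnj (u $ i) * v $ i)"

definition outer :: "complex^'n \<Rightarrow> complex^'n^'n" where
  "outer d = (\<chi> i j. d $ i * cnj (d $ j))"

lemma quad_form_eq_cdot: "quad_form A x = cdot x (A *v x)"
  by (simp add: quad_form_def cdot_def)

lemma cdot_add_left: "cdot (u + v) w = cdot u w + cdot v w"
  by (simp add: cdot_def algebra_simps sum.distrib)

lemma cdot_add_right: "cdot w (u + v) = cdot w u + cdot w v"
  by (simp add: cdot_def algebra_simps sum.distrib)

lemma cdot_scale_left: "cdot (c *s u) v = cnj c * cdot u v"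
  by (simp add: cdot_def sum_distrib_left algebra_simps)

lemma cdot_scale_right: "cdot u (c *s v) = c * cdot u v"
  by (simp add: cdot_def sum_distrib_left algebra_simps)

lemma cdot_sum_left: "cdot (sum f I) v = (\<Sum>k\<in>I. cdot (f k) v)"
  by (induction I rule: infinite_finite_induct) (simp_all add: cdot_add_left, simp_all add: cdot_def)

lemma cdot_sum_right: "cdot v (sum f I) = (\<Sum>k\<in>I. cdot v (f k))"
  by (induction I rule: infinite_finite_induct) (simp_all add: cdot_add_right, simp_all add: cdot_def)

lemma cnj_cdot: "cnj (cdot u v) = cdot v u"
  by (simp add: cdot_def mult.commute)

lemma Re_cdot_commute: "Re (cdot u v) = Re (cdot v u)"
  using arg_cong[OF cnj_cdot[of u v], of Re] by simp

lemma cdot_self: "cdot x x = complex_of_real ((norm x)\<^sup>2)"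
proof -
  have "(norm x)\<^sup>2 = (\<Sum>i\<in>UNIV. (cmod (x $ i))\<^sup>2)"
    by (simp add: norm_vec_def L2_set_def sum_nonneg)
  then show ?thesis
    by (simp add: cdot_def complex_norm_square mult.commute del: of_real_power)
qed

lemma cdot_matrix_right: "cdot u (A *v v) = cdot (ctranspose A *v u) v"
proof -
  have "cdot u (A *v v) = (\<Sum>i\<in>UNIV. \<Sum>j\<in>UNIV. cnj (u $ i) * (A $ i $ j * v $ j))"
    by (simp add: cdot_def matrix_vector_mult_def sum_distrib_left)
  also have "\<dots> = (\<Sum>j\<in>UNIV. \<Sum>i\<in>UNIV. cnj (u $ i) * (A $ i $ j * v $ j))"
    by (rule sum.swap)
  also have "\<dots> = cdot (ctranspose A *v u) v"
    by (simp add: cdot_def matrix_vector_mult_def ctranspose_def sum_distrib_right sum_distrib_left algebra_simps)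
  finally show ?thesis .
qed

lemma ctranspose_ctranspose [simp]: "ctranspose (ctranspose A) = A"
  by (simp add: ctranspose_def vec_eq_iff)

lemma ctranspose_mult: "ctranspose (A ** B) = ctranspose B ** ctranspose A"
  by (simp add: ctranspose_def matrix_matrix_mult_def vec_eq_iff mult.commute)

lemma ctranspose_add: "ctranspose (A + B) = ctranspose A + ctranspose B"
  by (simp add: ctranspose_def vec_eq_iff)

lemma ctranspose_diff: "ctranspose (A - B) = ctranspose A - ctranspose B"
  by (simp add: ctranspose_def vec_eq_iff)

lemma ctranspose_scaleR: "ctranspose (c *\<^sub>R A) = c *\<^sub>R ctranspose A"
  by (simp add: ctranspose_def vec_eq_iff)

lemma ctranspose_mat_1 [simp]: "ctranspose (mat 1) = mat 1"
  by (auto simp add: ctranspose_def mat_def vec_eq_iff)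

lemma trace_ctranspose_mult:
  "trace (ctranspose F ** C) = (\<Sum>i\<in>UNIV. \<Sum>j\<in>UNIV. cnj (F $ i $ j) * C $ i $ j)"
  unfolding trace_def matrix_matrix_mult_def ctranspose_def
  by (simp, rule sum.swap)

lemma inner_eq_Re_trace: "F \<bullet> C = Re (trace (ctranspose F ** C))"
  by (simp add: trace_ctranspose_mult inner_vec_def inner_complex_def)

lemma trace_mult_outer: "trace (A ** outer d) = cdot d (A *v d)"
  by (simp add: trace_def matrix_matrix_mult_def outer_def cdot_def matrix_vector_mult_def
      sum_distrib_left algebra_simps)

lemma trace_outer: "trace (outer d) = complex_of_real ((norm d)\<^sup>2)"
  using trace_mult_outer[of "mat 1" d] by (simp add: cdot_self)

lemma outer_mult: "A ** outer d ** ctranspose A = outer (A *v d)"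
  by (simp add: vec_eq_iff matrix_matrix_mult_def outer_def ctranspose_def matrix_vector_mult_def
      sum_distrib_left sum_distrib_right algebra_simps)

lemma outer_mult_vec: "outer d *v x = cdot d x *s d"
  by (simp add: vec_eq_iff outer_def cdot_def matrix_vector_mult_def sum_distrib_left
      sum_distrib_right algebra_simps)

lemma hermitian_cdot: "hermitian A \<Longrightarrow> cdot u (A *v v) = cdot (A *v u) v"
  by (simp add: cdot_matrix_right hermitian_def)

section \<open>The numerical radius along a chain of vectors\<close>

lemma sum_roots_of_unity:
  fixes M p k :: nat
  assumes "p < M" "k < M"
  shows "(\<Sum>s<M. cnj (cis (2 * pi * real s / real M)) ^ p * cis (2 * pi * real s / real M) ^ k)
    = (if p = k then of_nat M else 0)"
proof -
  define z where "z = cis (2 * pi * k / M - 2 * pi * p / M)"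
  have "cnj (cis (2 * pi * real s / real M)) ^ p * cis (2 * pi * real s / real M) ^ k = z ^ s" for s :: nat
  proof -
    have "real p * - (2 * pi * real s / real M) + real k * (2 * pi * real s / real M)
        = real s * (2 * pi * real k / real M - 2 * pi * real p / real M)"
      by (simp add: algebra_simps)
    then show ?thesis
      by (simp only: z_def cis_cnj Complex.DeMoivre cis_mult)
  qed
  then have eq: "(\<Sum>s<M. cnj (cis (2 * pi * real s / real M)) ^ p * cis (2 * pi * real s / real M) ^ k)
      = (\<Sum>s<M. z ^ s)"
    by simp
  have zM: "z ^ M = 1"
  proof -
    have "z = cis (2 * pi * k / M) / cis (2 * pi * p / M)"
      by (simp add: z_def cis_divide)
    moreover have "cis (2 * pi * real l / M) ^ M = 1" for l
    proof -
      have "cis (2 * pi * real l / M) ^ M = cis (2 * pi * real l)"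
        using assms by (simp add: Complex.DeMoivre)
      also have "\<dots> = cis (2 * pi) ^ l"
        by (simp only: Complex.DeMoivre mult.commute)
      finally show ?thesis by simp
    qed
    ultimately show ?thesis by (simp add: power_divide)
  qed
  show ?thesis
  proof (cases "p = k")
    case True
    then show ?thesis using eq by (simp add: z_def)
  next
    case False
    have "z \<noteq> 1"
    proof
      assume "z = 1"
      then have "cis (2 * pi * k / M) = cis (2 * pi * p / M)"
        by (simp add: z_def flip: cis_divide)
      then have "exp (2 * of_real pi * \<i> * of_nat k / of_nat M) = exp (2 * of_real pi * \<i> * of_nat p / of_nat M)"
        by (simp add: cis_conv_exp mult_ac)
      then show False
        using complex_root_unity_eq[of M k p] assms False by (simp add: cong_def)
    qed
    then show ?thesis using eq zM False geometric_sum[of z M] by simp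
  qed
qed

lemma matrix_vector_mult_sum:
  fixes A :: "complex^'n^'m"
  shows "A *v (sum f I) = (\<Sum>k\<in>I. A *v f k)"
  by (induction I rule: infinite_finite_induct) (simp_all add: matrix_vector_right_distrib)

text \<open>Replacing \<open>a k\<close> by \<open>w\<^sup>k a k\<close> multiplies the \<open>(j, k)\<close> term of the expanded quadratic
  form by \<open>w\<^sup>k\<^sup>-\<^sup>j\<close>, so averaging over the roots of unity \<open>w\<close> against \<open>w\<^sup>-\<^sup>p\<close> isolates
  the terms with \<open>k = j + p\<close>. The bound on \<open>M\<close> keeps all exponents below \<open>M\<close>, which excludes
  aliasing. It is applied with \<open>p = 1\<close> to \<open>F\<close> and with \<open>p = 0\<close> to the identity.\<close>

lemma sum_rotations_quad_form:
  fixes a :: "nat \<Rightarrow> complex^'n"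
  assumes "m + p < M"
  shows "(\<Sum>s<M. cnj (cis (2 * pi * real s / real M)) ^ p *
           quad_form G (\<Sum>k\<le>m. cis (2 * pi * real s / real M) ^ k *s a k))
       = of_nat M * (\<Sum>j\<le>m. if j + p \<le> m then cdot (a j) (G *v a (j + p)) else 0)"
proof -
  define w where "w s = cis (2 * pi * real s / real M)" for s
  have q: "quad_form G (\<Sum>k\<le>m. w s ^ k *s a k)
      = (\<Sum>j\<le>m. \<Sum>k\<le>m. cnj (w s) ^ j * w s ^ k * cdot (a j) (G *v a k))" for s
    by (subst sum.swap) (simp add: quad_form_eq_cdot matrix_vector_mult_sum vector_scalar_commute
      cdot_sum_left cdot_sum_right cdot_scale_left cdot_scale_right sum_distrib_left mult_ac)
  have "(\<Sum>s<M. cnj (w s) ^ p * quad_form G (\<Sum>k\<le>m. w s ^ k *s a k))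
     = (\<Sum>s<M. \<Sum>j\<le>m. \<Sum>k\<le>m. (cnj (w s) ^ (j + p) * w s ^ k) * cdot (a j) (G *v a k))"
    by (simp add: q sum_distrib_left power_add mult_ac)
  also have "\<dots> = (\<Sum>j\<le>m. \<Sum>k\<le>m. \<Sum>s<M. (cnj (w s) ^ (j + p) * w s ^ k) * cdot (a j) (G *v a k))"
    by (subst sum.swap, rule sum.cong[OF refl], rule sum.swap)
  also have "\<dots> = (\<Sum>j\<le>m. \<Sum>k\<le>m. (if j + p = k then of_nat M else 0) * cdot (a j) (G *v a k))"
    using assms by (intro sum.cong refl)
      (simp add: w_def sum_roots_of_unity flip: sum_distrib_right)
  also have "\<dots> = (\<Sum>j\<le>m. if j + p \<le> m then of_nat M * cdot (a j) (G *v a (j + p)) else 0)"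
  proof (rule sum.cong[OF refl])
    fix j
    have "(\<Sum>k\<le>m. (if j + p = k then of_nat M else 0) * cdot (a j) (G *v a k))
       = (\<Sum>k\<le>m. if j + p = k then of_nat M * cdot (a j) (G *v a k) else 0)"
      by (rule sum.cong) auto
    then show "(\<Sum>k\<le>m. (if j + p = k then of_nat M else 0) * cdot (a j) (G *v a k))
       = (if j + p \<le> m then of_nat M * cdot (a j) (G *v a (j + p)) else 0)"
      by (simp add: sum.delta)
  qed
  finally show ?thesis
    by (simp add: w_def sum_distrib_left if_distrib cong: if_cong)
qed

text \<open>With \<open>y = (\<Sum>k\<le>m. w\<^sup>k a k)\<close>, the hypothesis gives
  \<open>Re (w\<^sup>-\<^sup>1 y\<^sup>* F y) \<le> (norm y)\<^sup>2\<close> for each root of unity \<open>w\<close>; the two sides of the claim are the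
  averages over \<open>w\<close> of the two sides of this inequality.\<close>

lemma chain_inequality:
  fixes F :: "complex^'n^'n" and a :: "nat \<Rightarrow> complex^'n"
  assumes "numerical_radius F \<le> 1"
  shows "(\<Sum>k<m. Re (cdot (a k) (F *v a (Suc k)))) \<le> (\<Sum>k\<le>m. (norm (a k))\<^sup>2)"
proof -
  \<comment> \<open>The smallest order for which the exponents \<open>0, \<dots>, m + 1\<close> are distinct modulo \<open>M\<close>.\<close>
  define M where "M = m + 2"
  define w where "w s = cis (2 * pi * real s / real M)" for s
  define y where "y s = (\<Sum>k\<le>m. w s ^ k *s a k)" for s
  have le: "Re (cnj (w s) * quad_form F (y s)) \<le> (norm (y s))\<^sup>2" for s
  proof -
    have "Re (cnj (w s) * quad_form F (y s)) \<le> cmod (cnj (w s) * quad_form F (y s))"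
      by (rule complex_Re_le_cmod)
    also have "\<dots> = cmod (quad_form F (y s))"
      by (simp add: norm_mult w_def)
    also have "\<dots> \<le> 1 * (norm (y s))\<^sup>2"
      by (rule order_trans[OF cmod_quad_form_le]) (intro mult_right_mono assms, simp)
    finally show ?thesis by simp
  qed
  have 1: "(\<Sum>s<M. cnj (w s) * quad_form F (y s)) = of_nat M * (\<Sum>k<m. cdot (a k) (F *v a (Suc k)))"
  proof -
    have "(\<Sum>j\<le>m. if j + 1 \<le> m then cdot (a j) (F *v a (j + 1)) else 0)
        = (\<Sum>k<m. cdot (a k) (F *v a (Suc k)))"
      by (rule sum.mono_neutral_cong_right) auto
    then show ?thesis
      using sum_rotations_quad_form[of m 1 M F a] by (simp add: w_def y_def M_def del: sum.lessThan_Suc)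
  qed
  have 2: "(\<Sum>s<M. (norm (y s))\<^sup>2) = M * (\<Sum>k\<le>m. (norm (a k))\<^sup>2)"
  proof -
    have "complex_of_real (\<Sum>s<M. (norm (y s))\<^sup>2) = complex_of_real (M * (\<Sum>k\<le>m. (norm (a k))\<^sup>2))"
      using sum_rotations_quad_form[of m 0 M "mat 1" a]
      by (simp add: w_def y_def M_def quad_form_eq_cdot cdot_self)
    then show ?thesis using of_real_eq_iff by blast
  qed
  have "M * (\<Sum>k<m. Re (cdot (a k) (F *v a (Suc k)))) = (\<Sum>s<M. Re (cnj (w s) * quad_form F (y s)))"
    using arg_cong[OF 1, of Re] by simp
  also have "\<dots> \<le> M * (\<Sum>k\<le>m. (norm (a k))\<^sup>2)"
    unfolding 2[symmetric] by (intro sum_mono le)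
  finally show ?thesis by (simp add: M_def)
qed

section \<open>Positive semidefinite matrices\<close>

lemma quad_form_add: "quad_form (A + B) x = quad_form A x + quad_form B x"
  by (simp add: quad_form_eq_cdot matrix_vector_mult_add_rdistrib cdot_add_right)

lemma quad_form_scaleR: "quad_form (c *\<^sub>R A) x = c *\<^sub>R quad_form A x"
  by (simp add: quad_form_expand scaleR_sum_right)

lemma quad_form_diff: "quad_form (A - B) x = quad_form A x - quad_form B x"
  using quad_form_add[of "A - B" B x] by simp

lemma quad_form_outer: "quad_form (outer d) x = complex_of_real ((cmod (cdot d x))\<^sup>2)"
  by (simp add: quad_form_eq_cdot outer_mult_vec cdot_scale_right complex_norm_square
      cnj_cdot mult.commute del: of_real_power)

lemma hermitian_outer: "hermitian (outer d)"
  by (simp add: hermitian_def ctranspose_def outer_def vec_eq_iff mult.commute)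

text \<open>Expand the form at \<open>c u + v\<close> and minimise over \<open>c\<close>. When \<open>quad_form A u\<close> vanishes, the
  expansion is affine in \<open>c\<close>; it is bounded below only if its slope \<open>cdot u (A *v v)\<close> is zero, and
  large negative multiples of the slope as values of \<open>c\<close> show this.\<close>

lemma psd_Cauchy_Schwarz:
  assumes "psd A"
  shows "(cmod (cdot u (A *v v)))\<^sup>2 \<le> Re (quad_form A u) * Re (quad_form A v)"
proof -
  have herm: "hermitian A" using assms by (simp add: psd_def)
  define b where "b = cdot u (A *v v)"
  define p q where "p = Re (quad_form A u)" and "q = Re (quad_form A v)"
  have sym: "cdot v (A *v u) = cnj b"
    using hermitian_cdot[OF herm, of v u] by (simp add: b_def cnj_cdot)
  have pos: "0 \<le> p * (cmod c)\<^sup>2 + 2 * Re (cnj c * b) + q" for c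
  proof -
    have "quad_form A (c *s u + v) = c * cnj c * quad_form A u + cnj c * b + c * cnj b + quad_form A v"
      by (simp add: quad_form_eq_cdot matrix_vector_right_distrib vector_scalar_commute
        cdot_add_left cdot_add_right cdot_scale_left cdot_scale_right sym b_def algebra_simps)
    moreover have "Re (c * cnj c * quad_form A u) = p * (cmod c)\<^sup>2"
      by (simp add: p_def flip: complex_norm_square of_real_power)
    moreover have "Re (c * cnj b) = Re (cnj c * b)" by simp
    moreover have "0 \<le> Re (quad_form A (c *s u + v))" using assms by (simp add: psd_def)
    ultimately show ?thesis by (simp add: q_def algebra_simps)
  qed
  have p0: "0 \<le> p" using assms by (simp add: psd_def p_def)
  have Re_b: "Re (cnj (complex_of_real t * b) * b) = t * (cmod b)\<^sup>2" for t
    unfolding cmod_power2 by (simp add: power2_eq_square distrib_left)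
  have "(cmod b)\<^sup>2 \<le> p * q"
  proof (cases "p = 0")
    case True
    have b: "0 \<le> 2 * (t * (cmod b)\<^sup>2) + q" for t
      using pos[of "complex_of_real t * b"] unfolding Re_b by (simp add: True)
    have "cmod b = 0"
    proof (rule ccontr)
      assume "cmod b \<noteq> 0"
      then have "2 * ((- (q + 1) / (cmod b)\<^sup>2) * (cmod b)\<^sup>2) + q = - q - 2"
        by simp
      moreover have "0 \<le> q" using assms by (simp add: psd_def q_def)
      ultimately show False using b[of "- (q + 1) / (cmod b)\<^sup>2"] by linarith
    qed
    then show ?thesis by (simp add: True)
  next
    case False
    have "0 \<le> p * (cmod (complex_of_real (- 1 / p) * b))\<^sup>2 + 2 * (- 1 / p * (cmod b)\<^sup>2) + q"
      using pos[of "complex_of_real (- 1 / p) * b"] unfolding Re_b .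
    also have "\<dots> = q - (cmod b)\<^sup>2 / p"
      using False by (simp add: norm_mult power_mult_distrib norm_divide power2_eq_square field_simps)
    finally show ?thesis using p0 False by (simp add: field_simps)
  qed
  then show ?thesis by (simp add: b_def p_def q_def)
qed

text \<open>A positive semidefinite matrix is a sum of matrices \<open>outer d\<close>. This is Cholesky elimination:
  if \<open>Y\<^sub>i\<^sub>i \<noteq> 0\<close>, then subtracting the outer product of the scaled column \<open>i\<close> of \<open>Y\<close> leaves a
  positive semidefinite matrix, by the Cauchy-Schwarz inequality, and clears the diagonal entry
  \<open>i\<close> without creating new nonzero diagonal entries. The rule hides the decomposition and keeps only
  what additive functionals need.\<close>

lemma additive_nonneg_on_psd:
  fixes f :: "complex^'n^'n \<Rightarrow> real"
  assumes "psd Y"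
    and zero: "f 0 = 0" and add: "\<And>A B. f (A + B) = f A + f B"
    and outer: "\<And>d. 0 \<le> f (outer d)"
  shows "0 \<le> f Y"
  using \<open>psd Y\<close>
proof (induction "card {i. Y $ i $ i \<noteq> 0}" arbitrary: Y rule: less_induct)
  case less
  have herm: "hermitian Y" using less.prems by (simp add: psd_def)
  have col: "Y *v axis i 1 = (\<chi> j. Y $ j $ i)" for i
  proof -
    have "(Y *v axis i 1) $ j = (\<Sum>k\<in>UNIV. if k = i then Y $ j $ k else 0)" for j
      unfolding matrix_vector_mult_def vec_lambda_beta by (rule sum.cong) (auto simp: axis_def)
    then show ?thesis by (simp add: vec_eq_iff)
  qed
  have ax: "cdot (axis j 1) v = v $ j" for j :: 'n and v
  proof -
    have "cdot (axis j 1) v = (\<Sum>i\<in>UNIV. if i = j then v $ i else 0)"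
      unfolding cdot_def by (rule sum.cong) (auto simp: axis_def)
    then show ?thesis by simp
  qed
  have diag: "quad_form Y (axis i 1) = Y $ i $ i" for i
    by (simp add: quad_form_eq_cdot col ax)
  have sym: "cnj (Y $ i $ j) = Y $ j $ i" for i j
    using herm by (simp add: hermitian_def ctranspose_def vec_eq_iff)
  show ?case
  proof (cases "\<forall>i. Y $ i $ i = 0")
    case True
    have "Y $ i $ j = 0" for i j
      using psd_Cauchy_Schwarz[OF less.prems, of "axis i 1" "axis j 1"]
      by (simp add: col ax diag True)
    then have "Y = 0" by (simp add: vec_eq_iff)
    then show ?thesis by (simp add: zero)
  next
    case False
    then obtain i where i: "Y $ i $ i \<noteq> 0" by blast
    define p where "p = Re (Y $ i $ i)"
    have Yii: "Y $ i $ i = complex_of_real p"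
      using sym[of i i] by (simp add: p_def complex_eq_iff)
    have "0 \<le> p" using less.prems diag[of i] by (simp add: psd_def p_def) metis
    with i Yii have p: "0 < p" by (cases "p = 0") auto
    define d where "d = complex_of_real (1 / sqrt p) *s (Y *v axis i 1)"
    define Z where "Z = Y - outer d"
    have cd: "(cmod (cdot d x))\<^sup>2 = (cmod (cdot (axis i 1) (Y *v x)))\<^sup>2 / p" for x
      using p by (simp add: d_def cdot_scale_left hermitian_cdot[OF herm] norm_mult power_mult_distrib norm_divide
        power_divide)
    have "psd Z"
    proof -
      have "hermitian Z"
        using herm hermitian_outer[of d] by (simp add: Z_def hermitian_def ctranspose_diff)
      moreover have "0 \<le> Re (quad_form Z x)" for x
        using psd_Cauchy_Schwarz[OF less.prems, of "axis i 1" x] p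
        by (simp add: Z_def quad_form_diff quad_form_outer cd diag Yii field_simps)
      ultimately show ?thesis by (simp add: psd_def)
    qed
    moreover have "card {j. Z $ j $ j \<noteq> 0} < card {j. Y $ j $ j \<noteq> 0}"
    proof (rule psubset_card_mono)
      have dj: "outer d $ j $ j = complex_of_real ((cmod (Y $ j $ i))\<^sup>2 / p)" for j
      proof -
        have "outer d $ j $ j = complex_of_real ((cmod (d $ j))\<^sup>2)"
          by (simp add: outer_def complex_norm_square del: of_real_power)
        moreover have "(cmod (d $ j))\<^sup>2 = (cmod (Y $ j $ i))\<^sup>2 / p"
          using p by (simp add: d_def col norm_mult norm_divide power_mult_distrib power_divide)
        ultimately show ?thesis by simp
      qed
      have "Z $ i $ i = 0"
        using p by (simp add: Z_def dj Yii power2_eq_square)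
      moreover have "Z $ j $ j = 0" if "Y $ j $ j = 0" for j
        using psd_Cauchy_Schwarz[OF less.prems, of "axis j 1" "axis i 1"] that
        by (simp add: Z_def dj col ax diag)
      ultimately show "{j. Z $ j $ j \<noteq> 0} \<subset> {j. Y $ j $ j \<noteq> 0}"
        using i by blast
    qed simp
    ultimately have "0 \<le> f Z" using less.hyps by blast
    moreover have "f Y = f Z + f (outer d)"
      using add[of Z "outer d"] by (simp add: Z_def)
    ultimately show ?thesis using outer[of d] by simp
  qed
qed

section \<open>Block matrices with equal diagonal blocks\<close>

lemma quad_form_block2:
  fixes A B C D :: "complex^'n^'n"
  shows "quad_form (block2 A B C D) z =
    (let u = (\<chi> i. z $ Inl i); v = (\<chi> i. z $ Inr i)
     in cdot u (A *v u) + cdot u (B *v v) + cdot v (C *v u) + cdot v (D *v v))"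
  unfolding quad_form_expand UNIV_Plus_UNIV[symmetric]
  by (simp add: sum.Plus block2_def Let_def cdot_def matrix_vector_mult_def sum.distrib
    sum_distrib_left algebra_simps del: UNIV_Plus_UNIV)

lemma hermitian_block2_iff:
  "hermitian (block2 X C (ctranspose C) X) \<longleftrightarrow> hermitian X"
  by (auto simp: hermitian_def ctranspose_def block2_def vec_eq_iff split: sum.splits)

lemma psd_block2_iff:
  fixes X C :: "complex^'n^'n"
  shows "psd (block2 X C (ctranspose C) X) \<longleftrightarrow> hermitian X \<and>
    (\<forall>u v. 0 \<le> Re (quad_form X u) + 2 * Re (cdot u (C *v v)) + Re (quad_form X v))"
    (is "?lhs \<longleftrightarrow> _ \<and> (\<forall>u v. 0 \<le> ?q u v)")
proof -
  have "Re (cdot v (ctranspose C *v u)) = Re (cdot u (C *v v))" for u v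
    using Re_cdot_commute[of u "C *v v"] cdot_matrix_right[of v "ctranspose C" u] by simp
  then have q: "Re (quad_form (block2 X C (ctranspose C) X) z) = ?q (\<chi> i. z $ Inl i) (\<chi> i. z $ Inr i)" for z
    unfolding quad_form_block2 Let_def by (simp add: quad_form_eq_cdot)
  have "(\<forall>z. 0 \<le> Re (quad_form (block2 X C (ctranspose C) X) z)) \<longleftrightarrow> (\<forall>u v. 0 \<le> ?q u v)"
  proof (intro iffI allI)
    fix u v
    assume "\<forall>z. 0 \<le> Re (quad_form (block2 X C (ctranspose C) X) z)"
    from spec[OF this, of "\<chi> p. case p of Inl i \<Rightarrow> u $ i | Inr i \<Rightarrow> v $ i"]
    show "0 \<le> ?q u v" unfolding q by simp
  qed (simp add: q)
  then show ?thesis by (simp add: psd_def hermitian_block2_iff)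
qed

section \<open>Lower bound: weak duality\<close>

text \<open>If the columns of a matrix \<open>D\<close> are the vectors \<open>d\<close> and \<open>Y = D D\<^sup>*\<close>, this is the
  right side minus the left side of \<open>chain_inequality\<close> for the orbits \<open>d, N d, N\<^sup>2 d, \<dots>\<close>, summed over
  all \<open>d\<close>. Written in terms of \<open>Y\<close> alone it makes sense for every matrix and is additive in \<open>Y\<close>.\<close>

fun chain_form :: "complex^'n^'n \<Rightarrow> complex^'n^'n \<Rightarrow> nat \<Rightarrow> complex^'n^'n \<Rightarrow> real" where
  "chain_form F N 0 Y = Re (trace Y)"
| "chain_form F N (Suc m) Y =
     Re (trace Y) - Re (trace (ctranspose F ** (Y ** ctranspose N)))
       + chain_form F N m (N ** Y ** ctranspose N)"

lemma matrix_mult_add_left: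
  fixes A B :: "complex^'n^'m"
  shows "(A + B) ** D = A ** D + B ** D"
  by (simp add: matrix_matrix_mult_def vec_eq_iff distrib_right sum.distrib)

lemma chain_form_add: "chain_form F N m (A + B) = chain_form F N m A + chain_form F N m B"
  by (induction m arbitrary: A B)
    (simp_all add: trace_add matrix_add_ldistrib matrix_mult_add_left)

lemma chain_form_zero: "chain_form F N m 0 = 0"
  using chain_form_add[of F N m 0 0] by simp

lemma chain_form_outer:
  "chain_form F N m (outer d) =
     (\<Sum>k\<le>m. (norm ((((*v) N) ^^ k) d))\<^sup>2)
     - (\<Sum>k<m. Re (cdot ((((*v) N) ^^ k) d) (F *v (((*v) N) ^^ Suc k) d)))"
proof (induction m arbitrary: d)
  case 0
  then show ?case by (simp add: trace_outer del: of_real_power)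
next
  case (Suc m)
  have "trace (ctranspose F ** (outer d ** ctranspose N)) = cdot d ((ctranspose N ** ctranspose F) *v d)"
    by (metis matrix_mul_assoc trace_mul_sym trace_mult_outer)
  also have "\<dots> = cdot (F *v (N *v d)) d"
    by (simp add: cdot_matrix_right flip: matrix_vector_mul_assoc)
  finally have "Re (trace (ctranspose F ** (outer d ** ctranspose N))) = Re (cdot d (F *v (N *v d)))"
    using Re_cdot_commute by metis
  then show ?case
    by (simp add: Suc.IH outer_mult trace_outer sum.atMost_Suc_shift sum.lessThan_Suc_shift funpow_swap1
      del: of_real_power sum.atMost_Suc sum.lessThan_Suc)
qed

lemma chain_form_nonneg:
  assumes "numerical_radius F \<le> 1" "psd Y"
  shows "0 \<le> chain_form F N m Y"
  using assms(2) chain_form_zero chain_form_add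
proof (rule additive_nonneg_on_psd)
  show "0 \<le> chain_form F N m (outer d)" for d
    unfolding chain_form_outer
    using chain_inequality[OF assms(1), where a = "\<lambda>k. (((*v) N) ^^ k) d" and m = m] by simp
qed

text \<open>Let \<open>l\<close> be the claimed difference \<open>Re (trace X) - Re (trace (F\<^sup>* X N\<^sup>*))\<close>. Since
  \<open>N X N\<^sup>*\<close> lies below \<open>X\<close> in the positive semidefinite order and the chain functionals are monotone
  for that order, one more step of the chain costs at most \<open>l\<close>. After \<open>m\<close> steps the functional is
  therefore at most \<open>m l + Re (trace X)\<close>; it stays nonnegative for every \<open>m\<close>, so \<open>l\<close> cannot be
  negative.\<close>

lemma trace_bound_of_stationary:
  assumes F: "numerical_radius F \<le> 1" and X: "psd X" and E: "psd (X - N ** X ** ctranspose N)"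
  shows "Re (trace (ctranspose F ** (X ** ctranspose N))) \<le> Re (trace X)"
proof -
  define l where "l = Re (trace X) - Re (trace (ctranspose F ** (X ** ctranspose N)))"
  have step: "chain_form F N (Suc m) X \<le> l + chain_form F N m X" for m
    using chain_form_add[of F N m "X - N ** X ** ctranspose N" "N ** X ** ctranspose N"]
      chain_form_nonneg[OF F E, of N m] by (simp add: l_def)
  have bound: "chain_form F N m X \<le> m * l + Re (trace X)" for m
  proof (induction m)
    case (Suc m)
    then show ?case using step[of m] by (simp add: algebra_simps)
  qed simp
  have "0 \<le> l"
  \<comment> \<open>Otherwise the linear upper bound eventually drops below zero.\<close>
  proof (rule ccontr)
    assume "\<not> 0 \<le> l"
    then obtain m :: nat where "Re (trace X) < m * (- l)"
      using reals_Archimedean3[of "- l"] by auto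
    then show False
      using bound[of m] chain_form_nonneg[OF F X, of N m] by simp
  qed
  then show ?thesis by (simp add: l_def)
qed

text \<open>For invertible \<open>X\<close> the matrix \<open>N = C\<^sup>* X\<^sup>-\<^sup>1\<close> satisfies \<open>X N\<^sup>* = C\<close>, and
  \<open>X - N X N\<^sup>* = X - C\<^sup>* X\<^sup>-\<^sup>1 C\<close> is the Schur complement of the block matrix, hence positive
  semidefinite.\<close>

lemma weak_duality_pd:
  fixes X C :: "complex^'n^'n"
  assumes F: "numerical_radius F \<le> 1" and P: "psd (block2 X C (ctranspose C) X)"
    and ker: "\<And>x. X *v x = 0 \<Longrightarrow> x = 0"
  shows "Re (trace (ctranspose F ** C)) \<le> Re (trace X)"
proof -
  have herm: "ctranspose X = X"
    and q: "\<And>u v. 0 \<le> Re (quad_form X u) + 2 * Re (cdot u (C *v v)) + Re (quad_form X v)"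
    using P by (auto simp: psd_block2_iff hermitian_def)
  obtain W where WX: "W ** X = mat 1"
    using ker matrix_left_invertible_ker by blast
  then have XW: "X ** W = mat 1"
    by (simp add: matrix_left_right_inverse)
  have "ctranspose W = ctranspose W ** (X ** W)"
    by (simp add: XW)
  also have "\<dots> = W"
    by (metis WX ctranspose_mult ctranspose_mat_1 herm matrix_mul_assoc matrix_mul_lid)
  finally have Wh: "ctranspose W = W" .
  define N where "N = ctranspose C ** W"
  have NT: "ctranspose N = W ** C"
    by (simp add: N_def ctranspose_mult Wh)
  have XN: "X ** ctranspose N = C"
    by (simp add: NT matrix_mul_assoc XW)
  have NXN: "N ** X ** ctranspose N = ctranspose C ** W ** C"
    by (simp add: N_def XN flip: matrix_mul_assoc) (simp add: XN[unfolded N_def] matrix_mul_assoc)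
  have X: "psd X"
    using q[of _ 0] herm by (simp add: psd_def hermitian_def quad_form_eq_cdot) (simp add: cdot_def)
  have "psd (X - N ** X ** ctranspose N)"
    unfolding psd_def
  proof
    show "hermitian (X - N ** X ** ctranspose N)"
      unfolding NXN by (simp add: hermitian_def ctranspose_diff ctranspose_mult herm Wh matrix_mul_assoc)
    show "\<forall>x. 0 \<le> Re (quad_form (X - N ** X ** ctranspose N) x)"
    proof
      fix x
      define c where "c = C *v x"
      have XWc: "X *v (W *v c) = c"
        by (simp add: matrix_vector_mul_assoc XW)
      have "quad_form (N ** X ** ctranspose N) x = cdot c (W *v c)"
        unfolding NXN by (simp add: quad_form_eq_cdot c_def cdot_matrix_right flip: matrix_vector_mul_assoc)
      moreover have "Re (quad_form X ((- 1) *s (W *v c))) = Re (cdot c (W *v c))"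
        unfolding quad_form_eq_cdot vector_scalar_commute cdot_scale_left cdot_scale_right XWc
        by (simp add: Re_cdot_commute)
      moreover have "Re (cdot ((- 1) *s (W *v c)) (C *v x)) = - Re (cdot c (W *v c))"
        unfolding cdot_scale_left c_def[symmetric] by (simp add: Re_cdot_commute[of c])
      ultimately show "0 \<le> Re (quad_form (X - N ** X ** ctranspose N) x)"
        \<comment> \<open>For given \<open>x\<close> this first component minimises the form of the block matrix.\<close>
        using q[of "(- 1) *s (W *v c)" x] by (simp add: quad_form_diff)
    qed
  qed
  from trace_bound_of_stationary[OF F X this] show ?thesis
    by (simp add: XN)
qed

text \<open>A singular \<open>X\<close> is perturbed to the invertible \<open>X + \<delta> I\<close>, which keeps the block matrix
  positive semidefinite and changes the trace by an arbitrarily small amount.\<close>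

lemma weak_duality:
  fixes X C :: "complex^'n^'n"
  assumes F: "numerical_radius F \<le> 1" and P: "psd (block2 X C (ctranspose C) X)"
  shows "Re (trace (ctranspose F ** C)) \<le> Re (trace X)"
proof (rule field_le_epsilon)
  fix e :: real assume "0 < e"
  \<comment> \<open>The identity has trace \<open>CARD('n)\<close>, so the perturbation adds exactly \<open>e\<close> to the trace.\<close>
  define \<delta> where "\<delta> = e / CARD('n)"
  have d: "0 < \<delta>" using \<open>0 < e\<close> by (simp add: \<delta>_def)
  define X' where "X' = X + \<delta> *\<^sub>R mat 1"
  have qX': "Re (quad_form X' x) = Re (quad_form X x) + \<delta> * (norm x)\<^sup>2" for x
    unfolding X'_def quad_form_add quad_form_scaleR
    by (simp add: quad_form_eq_cdot cdot_self del: of_real_power)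
  have herm: "hermitian X"
    and q: "\<And>u v. 0 \<le> Re (quad_form X u) + 2 * Re (cdot u (C *v v)) + Re (quad_form X v)"
    using P by (auto simp: psd_block2_iff)
  have "psd (block2 X' C (ctranspose C) X')"
    unfolding psd_block2_iff qX'
  proof (intro conjI allI)
    show "hermitian X'"
      using herm by (simp add: hermitian_def X'_def ctranspose_add ctranspose_scaleR)
    show "0 \<le> Re (quad_form X u) + \<delta> * (norm u)\<^sup>2 + 2 * Re (cdot u (C *v v)) + (Re (quad_form X v) + \<delta> * (norm v)\<^sup>2)" for u v
    proof -
      have "0 \<le> \<delta> * (norm u)\<^sup>2" "0 \<le> \<delta> * (norm v)\<^sup>2" using d by simp_all
      then show ?thesis using q[of u v] by linarith
    qed
  qed
  moreover have "x = 0" if "X' *v x = 0" for x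
  proof -
    have "0 \<le> Re (quad_form X x)"
      using q[of x 0] by (simp add: quad_form_eq_cdot) (simp add: cdot_def)
    moreover have "Re (quad_form X' x) = 0"
      by (simp add: quad_form_eq_cdot that) (simp add: cdot_def)
    ultimately have "\<delta> * (norm x)\<^sup>2 \<le> 0"
      by (simp add: qX')
    then show ?thesis using d by (simp add: mult_le_0_iff)
  qed
  ultimately have "Re (trace (ctranspose F ** C)) \<le> Re (trace X')"
    using weak_duality_pd[OF F] by blast
  also have "\<dots> = Re (trace X) + e"
    by (simp add: X'_def trace_def mat_def sum.distrib \<delta>_def)
  finally show "Re (trace (ctranspose F ** C)) \<le> Re (trace X) + e" .
qed

section \<open>Attainment: the unit ball of the dual norm\<close>

text \<open>The matrices \<open>c x x\<^sup>*\<close> with \<open>cmod c = 1\<close> and \<open>norm x = 1\<close>. As functionals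
  \<open>F \<mapsto> Re (trace (F\<^sup>* Y))\<close> their supremum at \<open>F\<close> is the numerical radius of \<open>F\<close>, so their convex
  hull is the unit ball of the dual norm.\<close>

definition rotated_projections :: "(complex^'n^'n) set" where
  "rotated_projections = (\<lambda>(c, x). \<chi> i j. c * (x $ i * cnj (x $ j))) ` (sphere 0 1 \<times> sphere 0 1)"

lemma compact_rotated_projections: "compact rotated_projections"
  unfolding rotated_projections_def case_prod_unfold
  by (intro compact_continuous_image compact_Times compact_sphere continuous_intros)

lemma inner_rotated_projection:
  "F \<bullet> (\<chi> i j. c * (x $ i * cnj (x $ j))) = Re (c * cnj (quad_form F x))"
proof -
  have "(\<Sum>i\<in>UNIV. \<Sum>j\<in>UNIV. cnj (F $ i $ j) * (c * (x $ i * cnj (x $ j)))) = c * cnj (quad_form F x)"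
    by (simp add: quad_form_expand sum_distrib_left mult_ac)
  then show ?thesis
    by (simp add: inner_eq_Re_trace trace_ctranspose_mult)
qed

lemma numerical_radius_nonneg: "0 \<le> numerical_radius F"
  using numerical_radius_attained(1)[of F] by auto

lemma numerical_radius_scaleR_le:
  assumes "0 \<le> c"
  shows "numerical_radius (c *\<^sub>R F) \<le> c * numerical_radius F"
  using assms by (auto simp: numerical_radius_le_iff quad_form_scaleR norm_mult
    intro!: mult_left_mono numerical_radius_attained(2))

text \<open>The numerical radius is a modulus; the phase \<open>c\<close> is chosen to turn the maximising value
  \<open>x\<^sup>* F x\<close> into its modulus.\<close>

lemma numerical_radius_eq_inner:
  obtains Y where "Y \<in> rotated_projections" "F \<bullet> Y = numerical_radius F"
proof -
  obtain x where x: "norm x = 1" "numerical_radius F = cmod (quad_form F x)"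
    using numerical_radius_attained(1)[of F] by auto
  obtain c where c: "cmod c = 1" "c * cnj (quad_form F x) = complex_of_real (cmod (quad_form F x))"
  proof (cases "quad_form F x = 0")
    case True
    then show ?thesis using that[of 1] by simp
  next
    case False
    then have "quad_form F x / complex_of_real (cmod (quad_form F x)) * cnj (quad_form F x)
      = complex_of_real (cmod (quad_form F x))"
      by (simp add: field_simps power2_eq_square flip: complex_norm_square)
    with False that[of "quad_form F x / complex_of_real (cmod (quad_form F x))"] show ?thesis
      by (simp add: norm_divide)
  qed
  show thesis
  proof (rule that)
    show "(\<chi> i j. c * (x $ i * cnj (x $ j))) \<in> rotated_projections"
      using x c unfolding rotated_projections_def by (intro image_eqI[of _ _ "(c, x)"]) auto
    show "F \<bullet> (\<chi> i j. c * (x $ i * cnj (x $ j))) = numerical_radius F"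
      by (simp add: inner_rotated_projection c x)
  qed
qed

lemma dual_numerical_radius_bound:
  "F \<bullet> C \<le> dual_numerical_radius C * numerical_radius F"
proof (cases "numerical_radius F = 0")
  case True
  \<comment> \<open>Here \<open>F\<close> cannot be normalised, but it vanishes.\<close>
  then have "F = 0"
    using norm_entry_le[of F] by (simp add: vec_eq_iff)
  then show ?thesis using True by simp
next
  case False
  define r where "r = numerical_radius F"
  have r: "0 < r" using False numerical_radius_nonneg[of F] by (simp add: r_def)
  then have "numerical_radius ((1 / r) *\<^sub>R F) \<le> 1"
    using numerical_radius_scaleR_le[of "1 / r" F] by (simp add: r_def)
  then have "(1 / r) *\<^sub>R F \<bullet> C \<le> dual_numerical_radius C"
    using dual_numerical_radius_attained(2) by (simp only: inner_eq_Re_trace)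
  then show ?thesis using r by (simp add: r_def field_simps)
qed

lemma dual_numerical_radius_nonneg: "0 \<le> dual_numerical_radius C"
proof -
  have "numerical_radius (0 :: complex^'n^'n) \<le> 1"
    by (simp add: numerical_radius_le_iff quad_form_expand)
  from dual_numerical_radius_attained(2)[OF this, of C] show ?thesis
    by (simp flip: inner_eq_Re_trace)
qed

text \<open>The bipolar argument: a hyperplane separating \<open>C\<close> from the compact convex set would yield a
  matrix \<open>F\<close> for which \<open>Re (trace (F\<^sup>* C))\<close> exceeds the dual norm of \<open>C\<close> times the numerical radius
  of \<open>F\<close>.\<close>

lemma mem_scaled_hull:
  "C \<in> (*\<^sub>R) (dual_numerical_radius C) ` (convex hull rotated_projections)"
proof (rule ccontr)
  let ?\<rho> = "dual_numerical_radius C"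
  let ?K = "(*\<^sub>R) ?\<rho> ` (convex hull rotated_projections)"
  assume "C \<notin> ?K"
  have closed: "closed ?K"
    by (intro compact_imp_closed compact_scaling compact_convex_hull compact_rotated_projections)
  have "convex ?K"
    by (intro convex_scaling convex_convex_hull)
  from separating_hyperplane_closed_point[OF this closed \<open>C \<notin> ?K\<close>]
  obtain G b where G: "G \<bullet> C < b" and sep: "\<forall>Y\<in>?K. b < G \<bullet> Y"
    by auto
  obtain Y where Y: "Y \<in> rotated_projections" "- G \<bullet> Y = numerical_radius (- G)"
    by (rule numerical_radius_eq_inner)
  have "b < G \<bullet> (?\<rho> *\<^sub>R Y)"
    by (intro bspec[OF sep] imageI hull_inc Y(1))
  also have "\<dots> = - (?\<rho> * numerical_radius (- G))"
    by (simp flip: Y(2))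
  finally show False
    using G dual_numerical_radius_bound[of "- G" C] by simp
qed

text \<open>For \<open>Y = c x x\<^sup>*\<close> the choice \<open>X = x x\<^sup>*\<close> works, because the quadratic form of the block matrix at
  \<open>(u, v)\<close> is the square of the modulus of \<open>x\<^sup>* u + c x\<^sup>* v\<close>. The block matrix depends linearly on
  \<open>(X, Y)\<close>, so the property passes to convex combinations.\<close>

lemma hull_feasible:
  assumes "Y \<in> convex hull rotated_projections"
  shows "\<exists>X. psd (block2 X Y (ctranspose Y) X) \<and> trace X = 1"
proof -
  let ?Q = "{Y :: complex^'n^'n. \<exists>X. psd (block2 X Y (ctranspose Y) X) \<and> trace X = 1}"
  have "convex ?Q"
  proof (rule convexI)
    fix Y Z :: "complex^'n^'n" and s t :: real
    assume st: "0 \<le> s" "0 \<le> t" "s + t = 1" and "Y \<in> ?Q" "Z \<in> ?Q"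
    then obtain A B where A: "psd (block2 A Y (ctranspose Y) A)" "trace A = 1"
      and B: "psd (block2 B Z (ctranspose Z) B)" "trace B = 1" by blast
    have "psd (block2 (s *\<^sub>R A + t *\<^sub>R B) (s *\<^sub>R Y + t *\<^sub>R Z) (ctranspose (s *\<^sub>R Y + t *\<^sub>R Z)) (s *\<^sub>R A + t *\<^sub>R B))"
      unfolding psd_block2_iff
    proof (intro conjI allI)
      show "hermitian (s *\<^sub>R A + t *\<^sub>R B)"
        using A B by (simp add: psd_block2_iff hermitian_def ctranspose_add ctranspose_scaleR)
      fix u v
      have "cdot u ((s *\<^sub>R Y + t *\<^sub>R Z) *v v) = s *\<^sub>R cdot u (Y *v v) + t *\<^sub>R cdot u (Z *v v)"
        by (simp add: cdot_def matrix_vector_mult_def sum_distrib_left scaleR_sum_right sum.distrib algebra_simps)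
      moreover have "0 \<le> s * (Re (quad_form A u) + 2 * Re (cdot u (Y *v v)) + Re (quad_form A v))"
        and "0 \<le> t * (Re (quad_form B u) + 2 * Re (cdot u (Z *v v)) + Re (quad_form B v))"
        using A B st by (simp_all add: psd_block2_iff)
      ultimately show "0 \<le> Re (quad_form (s *\<^sub>R A + t *\<^sub>R B) u)
        + 2 * Re (cdot u ((s *\<^sub>R Y + t *\<^sub>R Z) *v v)) + Re (quad_form (s *\<^sub>R A + t *\<^sub>R B) v)"
        by (simp add: quad_form_add quad_form_scaleR algebra_simps)
    qed
    moreover have "trace (s *\<^sub>R A + t *\<^sub>R B) = 1"
    proof -
      have "trace (s *\<^sub>R A + t *\<^sub>R B) = s *\<^sub>R trace A + t *\<^sub>R trace B"
        by (simp add: trace_def sum.distrib scaleR_sum_right)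
      also have "\<dots> = 1"
        using st by (simp add: A B flip: of_real_add scaleR_left.add)
      finally show ?thesis .
    qed
    ultimately show "s *\<^sub>R Y + t *\<^sub>R Z \<in> ?Q" by blast
  qed
  moreover have "rotated_projections \<subseteq> ?Q"
  proof
    fix Z :: "complex^'n^'n" assume "Z \<in> rotated_projections"
    then obtain c x where c: "cmod c = 1" and x: "norm x = 1"
      and Z: "Z = (\<chi> i j. c * (x $ i * cnj (x $ j)))"
      by (auto simp: rotated_projections_def)
    have "psd (block2 (outer x) Z (ctranspose Z) (outer x))"
      unfolding psd_block2_iff
    proof (intro conjI allI hermitian_outer)
      fix u v
      have "Z *v v = c *s (outer x *v v)"
        by (simp add: Z outer_def vec_eq_iff matrix_vector_mult_def sum_distrib_left mult_ac)
      then have "cdot u (Z *v v) = cnj (cdot x u) * (c * cdot x v)"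
        by (simp add: outer_mult_vec cdot_scale_right cnj_cdot mult_ac)
      moreover have "0 \<le> (cmod (cdot x u + c * cdot x v))\<^sup>2" by simp
      moreover have "(cmod (cdot x u + c * cdot x v))\<^sup>2
          = (cmod (cdot x u))\<^sup>2 + 2 * Re (cnj (cdot x u) * (c * cdot x v)) + (cmod (c * cdot x v))\<^sup>2"
        unfolding cmod_power2 by (simp add: power2_eq_square algebra_simps)
      ultimately show "0 \<le> Re (quad_form (outer x) u) + 2 * Re (cdot u (Z *v v)) + Re (quad_form (outer x) v)"
        using c by (simp add: quad_form_outer norm_mult del: of_real_power)
    qed
    moreover have "trace (outer x) = 1" by (simp add: trace_outer x)
    ultimately show "Z \<in> ?Q" by blast
  qed
  ultimately have "convex hull rotated_projections \<subseteq> ?Q"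
    by (rule hull_minimal[rotated])
  then show ?thesis using assms by blast
qed

theorem theorem3p3:
  fixes C :: "complex^'n^'n"
  shows "let S = {t :: real. \<exists>X :: complex^'n^'n. hermitian X \<and>
                   psd (block2 X C (ctranspose C) X) \<and> complex_of_real t = trace X}
         in dual_numerical_radius C \<in> S \<and> (\<forall>t\<in>S. dual_numerical_radius C \<le> t)"
proof -
  let ?\<rho> = "dual_numerical_radius C"
  obtain Y X where C: "C = ?\<rho> *\<^sub>R Y" and P: "psd (block2 X Y (ctranspose Y) X)" and tr: "trace X = 1"
    using mem_scaled_hull hull_feasible by blast
  have "psd (block2 (?\<rho> *\<^sub>R X) C (ctranspose C) (?\<rho> *\<^sub>R X))"
    unfolding psd_block2_iff
  proof (intro conjI allI)
    show "hermitian (?\<rho> *\<^sub>R X)"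
      using P by (simp add: psd_block2_iff hermitian_def ctranspose_scaleR)
    fix u v
    have "cdot u (C *v v) = ?\<rho> *\<^sub>R cdot u (Y *v v)"
      by (subst C) (simp add: cdot_def matrix_vector_mult_def sum_distrib_left scaleR_sum_right)
    moreover have "0 \<le> ?\<rho> * (Re (quad_form X u) + 2 * Re (cdot u (Y *v v)) + Re (quad_form X v))"
      using P by (simp add: psd_block2_iff dual_numerical_radius_nonneg)
    ultimately show "0 \<le> Re (quad_form (?\<rho> *\<^sub>R X) u) + 2 * Re (cdot u (C *v v)) + Re (quad_form (?\<rho> *\<^sub>R X) v)"
      by (simp add: quad_form_scaleR algebra_simps)
  qed
  moreover from this have "hermitian (?\<rho> *\<^sub>R X)"
    by (simp add: psd_block2_iff)
  moreover have "trace (?\<rho> *\<^sub>R X) = ?\<rho> *\<^sub>R trace X"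
    by (simp add: trace_def scaleR_sum_right)
  then have "complex_of_real ?\<rho> = trace (?\<rho> *\<^sub>R X)"
    by (simp add: tr scaleR_conv_of_real)
  moreover have "?\<rho> \<le> t" if "psd (block2 X C (ctranspose C) X)" "complex_of_real t = trace X" for X t
  proof -
    obtain F where "numerical_radius F \<le> 1" "?\<rho> = Re (trace (ctranspose F ** C))"
      using dual_numerical_radius_attained(1)[of C] by blast
    then have "?\<rho> \<le> Re (trace X)" using weak_duality that(1) by metis
    then show ?thesis by (simp flip: that(2))
  qed
  ultimately show ?thesis by (auto simp: Let_def)
qed

end
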